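(* Consider the linear transport equation $u_t+(a(x,t)u)_x=0$ on $[x_a,x_b]$ with periodic boundary conditions and continuous velocity field $a$. Fix a polynomial degree $k\ge 0$, a time interval $[t^n,t^{n+1}]$, a space-time partition given by slopes $\nu_{j+\frac12}$, constants $\alpha_j$, and a numerical flux $\hat F$. Then the semi-discrete GEL DG scheme and the semi-discrete EL DG scheme that use this same space-time partition are equivalent. That is, a function $u_h(\cdot,t)$, $t\in[t^n,t^{n+1}]$, with $u_h(\cdot,t)|_{\tilde I_j(t)}\in P^k(\tilde I_j(t))$ for all $j$ (and coefficients differentiable in $t$) satisfies the semi-discrete GEL DG scheme if and only if it satisfies the semi-discrete EL DG scheme. Equivalently, the two schemes define the same system of ordinary differential equations for the coefficients of $u_h$.
   Context: Mesh: $x_a=x_{1/2}<x_{3/2}<\dots<x_{N+1/2}=x_b$, $I_j=[x_{j-1/2},x_{j+1/2}]$, and $x_j$ is the midpoint of $I_j$. $P^k(I)$ denotes polynomials of degree at most $k$ on $I$; $\Delta t=t^{n+1}-t^n$. All indices are understood periodically. Space-time partition: for given real slopes $\nu_{j+1/2}$ (the standard choice is $\nu_{j+1/2}=a(x_{j+1/2},t^{n+1})$), put $\tilde x_{j+1/2}(t)=x_{j+1/2}+(t-t^{n+1})\nu_{j+1/2}$, $\tilde I_j(t)=[\tilde x_{j-1/2}(t),\tilde x_{j+1/2}(t)]$, $\Delta x_j(t)=\tilde x_{j+1/2}(t)-\tilde x_{j-1/2}(t)$, and assume $\Delta x_j(t)>0$ for $t\in[t^n,t^{n+1}]$. Numerical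 flux: at the moving point $\tilde x_{j+1/2}(t)$ let $F(u)=(a(\tilde x_{j+1/2}(t),t)-\nu_{j+1/2})u$. Both schemes use the same monotone numerical flux $\hat F_{j+1/2}=\hat F(u_h^-,u_h^+)$ consistent with this $F$ (e.g. Lax-Friedrichs), where $u_h^\pm$ are the one-sided limits of $u_h(\cdot,t)$ at $\tilde x_{j+1/2}(t)$. Semi-discrete GEL DG scheme: let $\alpha_j$ be a real constant for each $j$ (the standard choice is $\alpha_j=a(x_j,t^{n+1})$). For all $j$, all $t\in[t^n,t^{n+1}]$ and all polynomials $\Psi$ of degree at most $k$, with test function $\psi(x,t)=\Psi(x-\alpha_j(t-t^{n+1}))$ (the solution of $\psi_t+\alpha_j\psi_x=0$, $\psi(\cdot,t^{n+1})=\Psi$), $$\frac{d}{dt}\int_{\tilde I_j(t)}u_h\psi\,dx=-\hat F_{j+1/2}\,\psi(\tilde x_{j+1/2}(t),t)+\hat F_{j-1/2}\,\psi(\tilde x_{j-1/2}(t),t)+\int_{\tilde I_j(t)}(a-\alpha_j)u_h\psi_x\,dx .$$ Semi-discrete EL DG scheme: let $$\alpha(x,t)=-\nu_{j-1/2}\frac{x-\tilde x_{j+1/2}(t)}{\Delta x_j(t)}+\nu_{j+1/2}\frac{x-\tilde x_{j-1/2}(t)}{\Delta x_j(t)},\qquad x\in\tilde I_j(t).$$ For all $j$, all $t\in[t^n,t^{n+1}]$ and all $\Psi\in P^k(I_j)$, let $\tilde\psi$ be the solution of $\tilde\psi_t+\alpha(x,t)\tilde\psi_x=0$, $\tilde\psi(\cdot,t^{n+1})=\Psi$;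 explicitly $\tilde\psi(x,t)=\Psi(\xi)$ when $\frac{x-\tilde x_{j-1/2}(t)}{\Delta x_j(t)}=\frac{\xi-x_{j-1/2}}{x_{j+1/2}-x_{j-1/2}}$. The scheme requires $$\frac{d}{dt}\int_{\tilde I_j(t)}u_h\tilde\psi\,dx=-\hat F_{j+1/2}\,\tilde\psi(\tilde x_{j+1/2}(t),t)+\hat F_{j-1/2}\,\tilde\psi(\tilde x_{j-1/2}(t),t)+\int_{\tilde I_j(t)}(a-\alpha)u_h\tilde\psi_x\,dx .$$ *)

theory Defs
  imports "HOL-Analysis.Analysis" "HOL-Computational_Algebra.Polynomial"
begin

text \<open>
  Half-integer indices are shifted to integers: for the interface families
  \<open>X\<close>, \<open>\<nu>\<close> and \<open>Fhat\<close>, index \<open>j\<close> stands for \<open>j + 1/2\<close>, so cell \<open>j\<close> lies between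
  the interfaces \<open>j - 1\<close> and \<open>j\<close>, and \<open>x\<^sub>a = X 0\<close>, \<open>x\<^sub>b = X N\<close>.  All families are indexed by
  \<^typ>\<open>int\<close> and periodic with period \<open>N\<close>; the mesh, \<open>a\<close> and \<open>u\<close> are extended periodically in space
  with period \<open>x\<^sub>b - x\<^sub>a\<close>.  The time interval is \<open>[t0, t1]\<close>, with \<open>t0 = t\<^sup>n\<close> and \<open>t1 = t\<^sup>n\<^sup>+\<^sup>1\<close>.
\<close>

definition periodic_mesh :: "nat \<Rightarrow> (int \<Rightarrow> real) \<Rightarrow> bool" where
  "periodic_mesh N X \<longleftrightarrow> N > 0 \<and> (\<forall>j. X (j - 1) < X j) \<and>
     (\<forall>j. X (j + int N) = X j + (X (int N) - X 0))"

definition iface :: "(int \<Rightarrow> real) \<Rightarrow> (int \<Rightarrow> real) \<Rightarrow> real \<Rightarrow> int \<Rightarrow> real \<Rightarrow> real" where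
  "iface X \<nu> t1 j t = X j + (t - t1) * \<nu> j"

definition cell_width :: "(int \<Rightarrow> real) \<Rightarrow> (int \<Rightarrow> real) \<Rightarrow> real \<Rightarrow> int \<Rightarrow> real \<Rightarrow> real" where
  "cell_width X \<nu> t1 j t = iface X \<nu> t1 j t - iface X \<nu> t1 (j - 1) t"

definition cell :: "(int \<Rightarrow> real) \<Rightarrow> (int \<Rightarrow> real) \<Rightarrow> real \<Rightarrow> int \<Rightarrow> real \<Rightarrow> real set" where
  "cell X \<nu> t1 j t = {iface X \<nu> t1 (j - 1) t .. iface X \<nu> t1 j t}"

definition space_time_partition ::
    "nat \<Rightarrow> (int \<Rightarrow> real) \<Rightarrow> (int \<Rightarrow> real) \<Rightarrow> real \<Rightarrow> real \<Rightarrow> bool" where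
  "space_time_partition N X \<nu> t0 t1 \<longleftrightarrow> periodic_mesh N X \<and> (\<forall>j. \<nu> (j + int N) = \<nu> j) \<and>
     (\<forall>j. \<forall>t\<in>{t0..t1}. cell_width X \<nu> t1 j t > 0)"

definition monotone_flux :: "(real \<Rightarrow> real \<Rightarrow> real) \<Rightarrow> bool" where
  "monotone_flux g \<longleftrightarrow> (\<forall>v. mono (\<lambda>u. g u v)) \<and> (\<forall>u. antimono (\<lambda>v. g u v))"

definition consistent_flux :: "(real \<Rightarrow> real \<Rightarrow> real) \<Rightarrow> (real \<Rightarrow> real) \<Rightarrow> bool" where
  "consistent_flux g F \<longleftrightarrow> (\<forall>u. g u u = F u)"

text \<open>
  The flux may depend on the interface and on time, since the function it is consistent with does.
\<close>

definition numerical_flux :: "nat \<Rightarrow> (real \<Rightarrow> real \<Rightarrow> real) \<Rightarrow> (int \<Rightarrow> real) \<Rightarrow> (int \<Rightarrow> real) \<Rightarrow>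
    real \<Rightarrow> real \<Rightarrow> (int \<Rightarrow> real \<Rightarrow> real \<Rightarrow> real \<Rightarrow> real) \<Rightarrow> bool" where
  "numerical_flux N a X \<nu> t0 t1 Fhat \<longleftrightarrow> (\<forall>j. Fhat (j + int N) = Fhat j) \<and>
     (\<forall>j. \<forall>t\<in>{t0..t1}. monotone_flux (Fhat j t) \<and>
        consistent_flux (Fhat j t) (\<lambda>u. (a (iface X \<nu> t1 j t) t - \<nu> j) * u))"

definition flux_value :: "(int \<Rightarrow> real \<Rightarrow> real \<Rightarrow> real \<Rightarrow> real) \<Rightarrow> (int \<Rightarrow> real) \<Rightarrow> (int \<Rightarrow> real) \<Rightarrow>
    real \<Rightarrow> (real \<Rightarrow> real \<Rightarrow> real) \<Rightarrow> int \<Rightarrow> real \<Rightarrow> real" where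
  "flux_value Fhat X \<nu> t1 u j t =
     Fhat j t (Lim (at_left (iface X \<nu> t1 j t)) (\<lambda>x. u x t))
              (Lim (at_right (iface X \<nu> t1 j t)) (\<lambda>x. u x t))"

text \<open>
  Functions in the approximation space are discontinuous at the interfaces, so they are required to
  be polynomial on the open cells only; their values at the interfaces play no role.
\<close>

definition dg_function :: "nat \<Rightarrow> nat \<Rightarrow> (int \<Rightarrow> real) \<Rightarrow> (int \<Rightarrow> real) \<Rightarrow> real \<Rightarrow> real \<Rightarrow>
    (real \<Rightarrow> real \<Rightarrow> real) \<Rightarrow> bool" where
  "dg_function k N X \<nu> t0 t1 u \<longleftrightarrow>
     (\<forall>t\<in>{t0..t1}. \<forall>x. u (x + (X (int N) - X 0)) t = u x t) \<and>
     (\<exists>p :: int \<Rightarrow> real \<Rightarrow> real poly. \<forall>j.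
        (\<forall>t\<in>{t0..t1}. degree (p j t) \<le> k \<and>
           (\<forall>x\<in>interior (cell X \<nu> t1 j t). u x t = poly (p j t) x)) \<and>
        (\<forall>i. (\<lambda>t. coeff (p j t) i) differentiable_on {t0..t1}))"

definition gel_test :: "(int \<Rightarrow> real) \<Rightarrow> real \<Rightarrow> int \<Rightarrow> real poly \<Rightarrow> real \<Rightarrow> real \<Rightarrow> real" where
  "gel_test \<alpha> t1 j \<Psi> x t = poly \<Psi> (x - \<alpha> j * (t - t1))"

text \<open>
  \<open>gel_dg_at \<dots> t\<close> and \<open>el_dg_at \<dots> t\<close> are the systems of equations of the two schemes at a single
  time \<open>t\<close>.  The time derivative is one-sided at the end points of the time interval.
\<close>

definition gel_dg_at :: "nat \<Rightarrow> (real \<Rightarrow> real \<Rightarrow> real) \<Rightarrow> (int \<Rightarrow> real) \<Rightarrow> (int \<Rightarrow> real) \<Rightarrow>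
    (int \<Rightarrow> real) \<Rightarrow> (int \<Rightarrow> real \<Rightarrow> real \<Rightarrow> real \<Rightarrow> real) \<Rightarrow> real \<Rightarrow> real \<Rightarrow>
    (real \<Rightarrow> real \<Rightarrow> real) \<Rightarrow> real \<Rightarrow> bool" where
  "gel_dg_at k a X \<nu> \<alpha> Fhat t0 t1 u t \<longleftrightarrow>
     (\<forall>j. \<forall>\<Psi>. degree \<Psi> \<le> k \<longrightarrow>
        ((\<lambda>s. integral (cell X \<nu> t1 j s) (\<lambda>x. u x s * gel_test \<alpha> t1 j \<Psi> x s))
          has_real_derivative
            (- flux_value Fhat X \<nu> t1 u j t * gel_test \<alpha> t1 j \<Psi> (iface X \<nu> t1 j t) t
             + flux_value Fhat X \<nu> t1 u (j - 1) t * gel_test \<alpha> t1 j \<Psi> (iface X \<nu> t1 (j - 1) t) t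
             + integral (cell X \<nu> t1 j t)
                 (\<lambda>x. (a x t - \<alpha> j) * u x t * deriv (\<lambda>y. gel_test \<alpha> t1 j \<Psi> y t) x)))
          (at t within {t0..t1}))"

definition gel_dg_scheme :: "nat \<Rightarrow> (real \<Rightarrow> real \<Rightarrow> real) \<Rightarrow> (int \<Rightarrow> real) \<Rightarrow> (int \<Rightarrow> real) \<Rightarrow>
    (int \<Rightarrow> real) \<Rightarrow> (int \<Rightarrow> real \<Rightarrow> real \<Rightarrow> real \<Rightarrow> real) \<Rightarrow> real \<Rightarrow> real \<Rightarrow>
    (real \<Rightarrow> real \<Rightarrow> real) \<Rightarrow> bool" where
  "gel_dg_scheme k a X \<nu> \<alpha> Fhat t0 t1 u \<longleftrightarrow>
     (\<forall>t\<in>{t0..t1}. gel_dg_at k a X \<nu> \<alpha> Fhat t0 t1 u t)"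

definition el_velocity :: "(int \<Rightarrow> real) \<Rightarrow> (int \<Rightarrow> real) \<Rightarrow> real \<Rightarrow> int \<Rightarrow> real \<Rightarrow> real \<Rightarrow> real" where
  "el_velocity X \<nu> t1 j x t =
     - \<nu> (j - 1) * ((x - iface X \<nu> t1 j t) / cell_width X \<nu> t1 j t)
     + \<nu> j * ((x - iface X \<nu> t1 (j - 1) t) / cell_width X \<nu> t1 j t)"

definition el_test :: "(int \<Rightarrow> real) \<Rightarrow> (int \<Rightarrow> real) \<Rightarrow> real \<Rightarrow> int \<Rightarrow> real poly \<Rightarrow>
    real \<Rightarrow> real \<Rightarrow> real" where
  "el_test X \<nu> t1 j \<Psi> x t =
     poly \<Psi> (X (j - 1) + (x - iface X \<nu> t1 (j - 1) t) / cell_width X \<nu> t1 j t * (X j - X (j - 1)))"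

text \<open>
  The two families of test functions solve the adjoint transport equations with final value \<open>\<Psi>\<close>.
\<close>

lemma gel_test_final: "gel_test \<alpha> t1 j \<Psi> x t1 = poly \<Psi> x"
  by (simp add: gel_test_def)

lemma gel_test_transport:
  "\<exists>dt dx. ((\<lambda>s. gel_test \<alpha> t1 j \<Psi> x s) has_real_derivative dt) (at t) \<and>
     ((\<lambda>y. gel_test \<alpha> t1 j \<Psi> y t) has_real_derivative dx) (at x) \<and> dt + \<alpha> j * dx = 0"
proof -
  let ?d = "poly (pderiv \<Psi>) (x - \<alpha> j * (t - t1))"
  have "((\<lambda>s. gel_test \<alpha> t1 j \<Psi> x s) has_real_derivative - \<alpha> j * ?d) (at t)"
    unfolding gel_test_def by (auto intro!: derivative_eq_intros)
  moreover have "((\<lambda>y. gel_test \<alpha> t1 j \<Psi> y t) has_real_derivative ?d) (at x)"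
    unfolding gel_test_def by (auto intro!: derivative_eq_intros)
  ultimately show ?thesis by fastforce
qed

lemma el_test_final:
  assumes "X (j - 1) < X j"
  shows "el_test X \<nu> t1 j \<Psi> x t1 = poly \<Psi> x"
  using assms by (simp add: el_test_def cell_width_def iface_def)

lemma el_test_transport:
  assumes w: "cell_width X \<nu> t1 j t > 0"
  shows "\<exists>dt dx. ((\<lambda>s. el_test X \<nu> t1 j \<Psi> x s) has_real_derivative dt) (at t) \<and>
     ((\<lambda>y. el_test X \<nu> t1 j \<Psi> y t) has_real_derivative dx) (at x) \<and>
     dt + el_velocity X \<nu> t1 j x t * dx = 0"
proof -
  let ?w = "cell_width X \<nu> t1 j t" and ?l = "iface X \<nu> t1 (j - 1) t" and ?h = "X j - X (j - 1)"
  let ?d = "poly (pderiv \<Psi>) (X (j - 1) + (x - ?l) / ?w * ?h)"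
  have dl: "((\<lambda>s. iface X \<nu> t1 i s) has_real_derivative \<nu> i) (at t)" for i
    unfolding iface_def by (auto intro!: derivative_eq_intros)
  have dw: "((\<lambda>s. cell_width X \<nu> t1 j s) has_real_derivative \<nu> j - \<nu> (j - 1)) (at t)"
    unfolding cell_width_def by (intro derivative_intros dl)
  have "((\<lambda>s. X (j - 1) + (x - iface X \<nu> t1 (j - 1) s) / cell_width X \<nu> t1 j s * ?h)
      has_real_derivative
        ((- \<nu> (j - 1)) * ?w - (x - ?l) * (\<nu> j - \<nu> (j - 1))) / (?w * ?w) * ?h) (at t)"
    using w by (auto intro!: derivative_eq_intros dl dw simp: algebra_simps)
  from DERIV_chain2[OF poly_DERIV this]
  have 1: "((\<lambda>s. el_test X \<nu> t1 j \<Psi> x s) has_real_derivative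
      ?d * (((- \<nu> (j - 1)) * ?w - (x - ?l) * (\<nu> j - \<nu> (j - 1))) / (?w * ?w) * ?h)) (at t)"
    unfolding el_test_def .
  have "((\<lambda>y. X (j - 1) + (y - ?l) / ?w * ?h) has_real_derivative 1 / ?w * ?h) (at x)"
    using w by (auto intro!: derivative_eq_intros)
  from DERIV_chain2[OF poly_DERIV this]
  have 2: "((\<lambda>y. el_test X \<nu> t1 j \<Psi> y t) has_real_derivative ?d * (1 / ?w * ?h)) (at x)"
    unfolding el_test_def .
  have r: "iface X \<nu> t1 j t = ?l + ?w"
    by (simp add: cell_width_def)
  have "el_velocity X \<nu> t1 j x t
      = - (((- \<nu> (j - 1)) * ?w - (x - ?l) * (\<nu> j - \<nu> (j - 1))) / ?w)"
    unfolding el_velocity_def r using w by (simp add: field_simps)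
  then have "?d * (((- \<nu> (j - 1)) * ?w - (x - ?l) * (\<nu> j - \<nu> (j - 1))) / (?w * ?w) * ?h)
      + el_velocity X \<nu> t1 j x t * (?d * (1 / ?w * ?h)) = 0"
    by simp
  with 1 2 show ?thesis by blast
qed

definition el_dg_at :: "nat \<Rightarrow> (real \<Rightarrow> real \<Rightarrow> real) \<Rightarrow> (int \<Rightarrow> real) \<Rightarrow> (int \<Rightarrow> real) \<Rightarrow>
    (int \<Rightarrow> real \<Rightarrow> real \<Rightarrow> real \<Rightarrow> real) \<Rightarrow> real \<Rightarrow> real \<Rightarrow>
    (real \<Rightarrow> real \<Rightarrow> real) \<Rightarrow> real \<Rightarrow> bool" where
  "el_dg_at k a X \<nu> Fhat t0 t1 u t \<longleftrightarrow>
     (\<forall>j. \<forall>\<Psi>. degree \<Psi> \<le> k \<longrightarrow>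
        ((\<lambda>s. integral (cell X \<nu> t1 j s) (\<lambda>x. u x s * el_test X \<nu> t1 j \<Psi> x s))
          has_real_derivative
            (- flux_value Fhat X \<nu> t1 u j t * el_test X \<nu> t1 j \<Psi> (iface X \<nu> t1 j t) t
             + flux_value Fhat X \<nu> t1 u (j - 1) t * el_test X \<nu> t1 j \<Psi> (iface X \<nu> t1 (j - 1) t) t
             + integral (cell X \<nu> t1 j t)
                 (\<lambda>x. (a x t - el_velocity X \<nu> t1 j x t) * u x t
                        * deriv (\<lambda>y. el_test X \<nu> t1 j \<Psi> y t) x)))
          (at t within {t0..t1}))"

definition el_dg_scheme :: "nat \<Rightarrow> (real \<Rightarrow> real \<Rightarrow> real) \<Rightarrow> (int \<Rightarrow> real) \<Rightarrow> (int \<Rightarrow> real) \<Rightarrow>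
    (int \<Rightarrow> real \<Rightarrow> real \<Rightarrow> real \<Rightarrow> real) \<Rightarrow> real \<Rightarrow> real \<Rightarrow>
    (real \<Rightarrow> real \<Rightarrow> real) \<Rightarrow> bool" where
  "el_dg_scheme k a X \<nu> Fhat t0 t1 u \<longleftrightarrow>
     (\<forall>t\<in>{t0..t1}. el_dg_at k a X \<nu> Fhat t0 t1 u t)"

end

theory Submission
  imports Defs
begin

text \<open>
  Both families of test functions have the form \<open>\<psi>(x, s) = \<Psi>(b s + c s x)\<close> with \<open>c \<noteq> 0\<close> and are
  transported by their velocity \<open>\<beta>\<close>.  Writing \<open>q\<close> for \<open>\<psi>(\<cdot>, t)\<close>, the derivative of
  \<open>\<integral> u (\<psi> - q)\<close> at time \<open>t\<close> is \<open>\<integral> u \<psi>\<^sub>t = - \<integral> \<beta> u q'\<close>, which is exactly the velocity term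
  on the right-hand side.  Hence either scheme at time \<open>t\<close>, tested with \<open>\<psi>\<close>, is equivalent to the same
  equation for the frozen test polynomial \<open>q\<close>, without any velocity; and \<open>\<Psi> \<mapsto> q\<close> is a bijection of
  the polynomials of degree at most \<open>k\<close>.
\<close>

section \<open>Coefficientwise time derivatives of polynomials\<close>

text \<open>Coefficientwise differentiation matches the regularity that \<open>dg_function\<close>
  grants, and makes the derivative itself a polynomial that can be integrated exactly.\<close>

definition has_poly_derivative ::
    "(real \<Rightarrow> real poly) \<Rightarrow> real poly \<Rightarrow> real \<Rightarrow> real set \<Rightarrow> bool" where
  "has_poly_derivative P D t S \<longleftrightarrow>
     (\<forall>i. ((\<lambda>s. coeff (P s) i) has_real_derivative coeff D i) (at t within S))"

lemma has_poly_derivative_const: "has_poly_derivative (\<lambda>s. q) 0 t S"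
  by (simp add: has_poly_derivative_def)

lemma has_poly_derivative_add:
  assumes "has_poly_derivative P D t S" "has_poly_derivative Q E t S"
  shows "has_poly_derivative (\<lambda>s. P s + Q s) (D + E) t S"
  using assms by (auto simp: has_poly_derivative_def intro!: derivative_intros)

lemma has_poly_derivative_diff:
  assumes "has_poly_derivative P D t S" "has_poly_derivative Q E t S"
  shows "has_poly_derivative (\<lambda>s. P s - Q s) (D - E) t S"
  using assms by (auto simp: has_poly_derivative_def intro!: derivative_intros)

lemma has_poly_derivative_mult:
  assumes P: "has_poly_derivative P D t S" and Q: "has_poly_derivative Q E t S"
  shows "has_poly_derivative (\<lambda>s. P s * Q s) (D * Q t + P t * E) t S"
  unfolding has_poly_derivative_def
proof
  fix i
  have "((\<lambda>s. \<Sum>m\<le>i. coeff (P s) m * coeff (Q s) (i - m)) has_real_derivative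
      (\<Sum>m\<le>i. coeff D m * coeff (Q t) (i - m) + coeff E (i - m) * coeff (P t) m)) (at t within S)"
    using P Q unfolding has_poly_derivative_def by (intro DERIV_sum DERIV_mult) auto
  then show "((\<lambda>s. coeff (P s * Q s) i) has_real_derivative coeff (D * Q t + P t * E) i)
      (at t within S)"
    by (simp add: coeff_mult sum.distrib mult.commute[of "coeff E _"])
qed

lemma has_poly_derivative_linear:
  assumes "(b has_real_derivative b') (at t within S)" "(c has_real_derivative c') (at t within S)"
  shows "has_poly_derivative (\<lambda>s. [:b s, c s:]) [:b', c':] t S"
  using assms by (auto simp: has_poly_derivative_def coeff_pCons split: nat.splits)

text \<open>Horner's scheme turns \<open>pcompose\<close> into repeated sums and products, so the
  chain rule follows from the product rule by induction on \<open>\<Psi>\<close>.\<close>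

lemma has_poly_derivative_pcompose:
  assumes L: "has_poly_derivative L D t S"
  shows "has_poly_derivative (\<lambda>s. pcompose \<Psi> (L s)) (D * pcompose (pderiv \<Psi>) (L t)) t S"
proof (induction \<Psi>)
  case 0
  then show ?case by (simp add: has_poly_derivative_const)
next
  case (pCons d \<Psi>)
  show ?case
    using has_poly_derivative_add[OF has_poly_derivative_const[of "[:d:]"]
        has_poly_derivative_mult[OF L pCons.IH]]
    by (simp add: pcompose_pCons pderiv_pCons pcompose_add algebra_simps)
qed

section \<open>Integrals of polynomials over moving intervals\<close>

lemma poly_eq_sum_le:
  fixes p :: "real poly"
  assumes "degree p \<le> n"
  shows "poly p x = (\<Sum>i\<le>n. coeff p i * x ^ i)"
  unfolding poly_altdef
  by (rule sum.mono_neutral_left) (use assms in \<open>auto simp: coeff_eq_0\<close>)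

text \<open>The range of summation is a free bound \<open>n\<close> rather than
  \<open>degree p\<close>, so that one fixed finite sum serves a whole family of polynomials whose
  degree varies with time.\<close>

lemma integral_poly_eq_sum:
  fixes p :: "real poly"
  assumes "degree p \<le> n" "l \<le> r"
  shows "integral {l..r} (poly p) =
    (\<Sum>i\<le>n. coeff p i * ((r ^ Suc i - l ^ Suc i) / Suc i))"
proof -
  have "((\<lambda>x. \<Sum>i\<le>n. coeff p i * (x ^ Suc i / Suc i)) has_vector_derivative poly p x)
      (at x within {l..r})" for x
    unfolding poly_eq_sum_le[OF assms(1)] has_real_derivative_iff_has_vector_derivative[symmetric]
    by (rule DERIV_sum) (auto intro!: derivative_eq_intros simp del: power_Suc)
  from integral_unique[OF fundamental_theorem_of_calculus[OF assms(2) this]]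
  show ?thesis
    by (simp add: sum_subtractf[symmetric] right_diff_distrib diff_divide_distrib del: power_Suc)
qed

lemma has_real_derivative_transform_within_set:
  fixes f g :: "real \<Rightarrow> real"
  assumes "t \<in> S" "\<And>s. s \<in> S \<Longrightarrow> f s = g s" "(g has_real_derivative D) (at t within S)"
  shows "(f has_real_derivative D) (at t within S)"
  using assms unfolding has_field_derivative_def by (blast intro: has_derivative_transform)

text \<open>With degrees bounded uniformly in time, the integral is a finite sum of coefficients
  times differences of end-point powers. The product rule applies termwise: differentiated
  coefficients give the integral of \<open>D\<close>, differentiated powers the end-point
  terms.\<close>

lemma Leibniz_integral_poly:
  assumes P: "has_poly_derivative P D t S" and t: "t \<in> S"
    and deg: "\<And>s. s \<in> S \<Longrightarrow> degree (P s) \<le> n"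
    and le: "\<And>s. s \<in> S \<Longrightarrow> l s \<le> r s"
    and l: "(l has_real_derivative l') (at t within S)"
    and r: "(r has_real_derivative r') (at t within S)"
  shows "((\<lambda>s. integral {l s..r s} (poly (P s))) has_real_derivative
    integral {l t..r t} (poly D) + (poly (P t) (r t) * r' - poly (P t) (l t) * l')) (at t within S)"
proof -
  \<comment> \<open>The hypotheses bound the degree of \<open>P s\<close> only, while the same sum
    must also represent \<open>D\<close>.\<close>
  define m where "m = max n (degree D)"
  have deg': "degree (P s) \<le> m" if "s \<in> S" for s
    using deg[OF that] by (simp add: m_def)
  have pw: "((\<lambda>s. f s ^ Suc i / Suc i) has_real_derivative f t ^ i * f') (at t within S)"
    if "(f has_real_derivative f') (at t within S)" for f f' i
    using that by (auto intro!: derivative_eq_intros simp del: power_Suc)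
  have "((\<lambda>s. \<Sum>i\<le>m. coeff (P s) i * (r s ^ Suc i / Suc i - l s ^ Suc i / Suc i))
      has_real_derivative
      (\<Sum>i\<le>m. coeff D i * (r t ^ Suc i / Suc i - l t ^ Suc i / Suc i)
        + (r t ^ i * r' - l t ^ i * l') * coeff (P t) i)) (at t within S)"
    using P unfolding has_poly_derivative_def
    by (intro DERIV_sum DERIV_mult DERIV_diff pw l r) auto
  moreover have "(\<Sum>i\<le>m. coeff D i * (r t ^ Suc i / Suc i - l t ^ Suc i / Suc i)
        + (r t ^ i * r' - l t ^ i * l') * coeff (P t) i) =
      integral {l t..r t} (poly D) + (poly (P t) (r t) * r' - poly (P t) (l t) * l')"
    using integral_poly_eq_sum[of D m "l t" "r t"] le[OF t]
    by (simp add: poly_eq_sum_le[OF deg'[OF t]] sum.distrib sum_distrib_left sum_distrib_right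
        sum_subtractf algebra_simps diff_divide_distrib m_def del: power_Suc)
  ultimately have "((\<lambda>s. \<Sum>i\<le>m. coeff (P s) i * (r s ^ Suc i / Suc i - l s ^ Suc i / Suc i))
      has_real_derivative
      integral {l t..r t} (poly D) + (poly (P t) (r t) * r' - poly (P t) (l t) * l'))
      (at t within S)"
    by simp
  then show ?thesis
    by (rule has_real_derivative_transform_within_set[OF t, rotated])
      (simp add: integral_poly_eq_sum[OF deg' le] diff_divide_distrib del: power_Suc)
qed

text \<open>The end points form a null set. This is what allows \<open>u\<close>, polynomial only on
  open cells, to be replaced by its polynomial under the integral.\<close>

lemma integral_cong_interior_Icc:
  fixes f g :: "real \<Rightarrow> real"
  assumes "\<And>x. x \<in> interior {l..r} \<Longrightarrow> f x = g x"
  shows "integral {l..r} f = integral {l..r} g"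
  by (rule integral_spike[of "{l, r}"]) (use assms in auto)

section \<open>Affine substitutions and frozen test polynomials\<close>

lemma pcompose_affine_inverse:
  fixes q :: "real poly"
  assumes "c \<noteq> 0"
  shows "pcompose (pcompose q [:- b / c, 1 / c:]) [:b, c:] = q"
  using assms by (simp add: pcompose_assoc[symmetric] pcompose_pCons)

lemma degree_pcompose_affine_le:
  fixes q :: "real poly"
  shows "degree (pcompose q [:b, c:]) \<le> degree q"
  using degree_pcompose_le[of q "[:b, c:]"]
  by (rule order_trans) (auto simp: degree_pCons_eq_if)

text \<open>
  \<open>A\<close> and \<open>B\<close> are the interface fluxes.
\<close>

definition frozen_equation where
  "frozen_equation S I u v A B l r t q \<longleftrightarrow>
     ((\<lambda>s. integral (I s) (\<lambda>x. u x s * poly q x)) has_real_derivative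
       - A * poly q r + B * poly q l
       + integral (I t) (\<lambda>x. v x * u x t * poly (pderiv q) x)) (at t within S)"

text \<open>Hypothesis \<open>\<beta>\<close> is the transport equation for \<open>\<psi>\<close> at
  time \<open>t\<close> with the common factor \<open>\<Psi>'\<close> cancelled. The two equations
  then differ by one and the same term, \<open>?K\<close>, on the left and on the right.\<close>

lemma moving_test_equation_iff_frozen:
  fixes u :: "real \<Rightarrow> real \<Rightarrow> real" and p :: "real \<Rightarrow> real poly"
  assumes t: "t \<in> S"
    and le: "\<And>s. s \<in> S \<Longrightarrow> l s \<le> r s"
    and l: "(l has_real_derivative l') (at t within S)"
    and r: "(r has_real_derivative r') (at t within S)"
    and u: "\<And>s x. s \<in> S \<Longrightarrow> x \<in> interior {l s..r s} \<Longrightarrow> u x s = poly (p s) x"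
    and deg: "\<And>s. s \<in> S \<Longrightarrow> degree (p s) \<le> k"
    and p: "has_poly_derivative p p' t S"
    and b: "(b has_real_derivative b') (at t within S)"
    and c: "(c has_real_derivative c') (at t within S)"
    and \<psi>: "\<And>x s. \<psi> x s = poly \<Psi> (b s + c s * x)"
    and \<beta>: "\<And>x. \<beta> x * c t = - (b' + c' * x)"
    and v: "continuous_on {l t..r t} v"
    and q: "q = pcompose \<Psi> [:b t, c t:]"
  shows "((\<lambda>s. integral {l s..r s} (\<lambda>x. u x s * \<psi> x s)) has_real_derivative
      - A * \<psi> (r t) t + B * \<psi> (l t) t
      + integral {l t..r t} (\<lambda>x. (v x - \<beta> x) * u x t * deriv (\<lambda>y. \<psi> y t) x)) (at t within S)
    \<longleftrightarrow> frozen_equation S (\<lambda>s. {l s..r s}) u v A B (l t) (r t) t q"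
    (is "(?G has_real_derivative ?G') _ \<longleftrightarrow> _")
proof -
  define Q where "Q s = pcompose \<Psi> [:b s, c s:]" for s
  define Q' where "Q' = [:b', c':] * pcompose (pderiv \<Psi>) [:b t, c t:]"
  have \<psi>Q: "\<psi> x s = poly (Q s) x" for x s
    by (simp add: \<psi> Q_def poly_pcompose mult.commute)
  have qQ: "q = Q t" by (simp add: q Q_def)
  have "deriv (\<lambda>y. \<psi> y t) x = poly (pderiv q) x" for x
    unfolding \<psi>Q qQ by (rule DERIV_imp_deriv[OF poly_DERIV])
  note d\<psi> = this
  have transport: "\<beta> x * poly (pderiv q) x = - poly Q' x" for x
  proof -
    have "\<beta> x * poly (pderiv q) x = (\<beta> x * c t) * poly (pderiv \<Psi>) (b t + c t * x)"
      by (simp add: q pderiv_pcompose pderiv_pCons poly_pcompose algebra_simps)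
    then show ?thesis
      unfolding \<beta> by (simp add: Q'_def poly_pcompose algebra_simps)
  qed
  let ?H = "\<lambda>s. integral {l s..r s} (\<lambda>x. u x s * poly q x)"
  let ?K = "integral {l t..r t} (poly (p t * Q'))"
  have G: "?G s = integral {l s..r s} (poly (p s * Q s))" if "s \<in> S" for s
    by (rule integral_cong_interior_Icc) (use u[OF that] in \<open>simp add: \<psi>Q\<close>)
  have H: "?H s = integral {l s..r s} (poly (p s * q))" if "s \<in> S" for s
    by (rule integral_cong_interior_Icc) (use u[OF that] in simp)
  have int: "f integrable_on {x..y}" if "continuous_on {x..y} f" for f :: "real \<Rightarrow> real" and x y
    using that by (rule integrable_continuous_interval)
  have GH: "integral {l s..r s} (poly (p s * (Q s - q))) = ?G s - ?H s" if "s \<in> S" for s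
    unfolding G[OF that] H[OF that]
    by (subst integral_diff[symmetric]) (auto intro!: int continuous_intros integral_cong simp: algebra_simps)
  \<comment> \<open>The factor \<open>Q s - q\<close> vanishes at \<open>s = t\<close>. Hence
    \<open>p'\<close> drops out of the derivative, and so do the end-point terms of the Leibniz
    rule: the motion of the cell contributes nothing.\<close>
  have "has_poly_derivative (\<lambda>s. p s * (Q s - q)) (p' * (Q t - q) + p t * (Q' - 0)) t S"
    unfolding Q_def Q'_def
    by (intro has_poly_derivative_mult has_poly_derivative_diff has_poly_derivative_const p
        has_poly_derivative_pcompose has_poly_derivative_linear b c)
  then have PD: "has_poly_derivative (\<lambda>s. p s * (Q s - q)) (p t * Q') t S"
    by (simp add: qQ)
  have "degree (p s * (Q s - q)) \<le> k + degree \<Psi>" if "s \<in> S" for s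
  proof -
    have "degree (Q s - q) \<le> degree \<Psi>"
      unfolding Q_def q by (intro degree_diff_le degree_pcompose_affine_le)
    with deg[OF that] degree_mult_le[of "p s" "Q s - q"] show ?thesis by linarith
  qed
  from Leibniz_integral_poly[OF PD t this le l r]
  have "((\<lambda>s. integral {l s..r s} (poly (p s * (Q s - q)))) has_real_derivative ?K) (at t within S)"
    by (simp add: qQ)
  then have diff: "((\<lambda>s. ?G s - ?H s) has_real_derivative ?K) (at t within S)"
    by (rule has_real_derivative_transform_within_set[OF t, rotated]) (simp add: GH)
  let ?R = "- A * poly q (r t) + B * poly q (l t)
    + integral {l t..r t} (\<lambda>x. v x * u x t * poly (pderiv q) x)"
  have "integral {l t..r t} (\<lambda>x. (v x - \<beta> x) * u x t * deriv (\<lambda>y. \<psi> y t) x) =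
      integral {l t..r t} (\<lambda>x. v x * poly (p t) x * poly (pderiv q) x + poly (p t * Q') x)"
  proof (rule integral_cong_interior_Icc)
    fix x assume "x \<in> interior {l t..r t}"
    then have "u x t = poly (p t) x" by (rule u[OF t])
    then have "(v x - \<beta> x) * u x t * deriv (\<lambda>y. \<psi> y t) x =
        v x * poly (p t) x * poly (pderiv q) x - poly (p t) x * (\<beta> x * poly (pderiv q) x)"
      by (simp add: d\<psi> algebra_simps)
    then show "(v x - \<beta> x) * u x t * deriv (\<lambda>y. \<psi> y t) x =
        v x * poly (p t) x * poly (pderiv q) x + poly (p t * Q') x"
      by (simp add: transport)
  qed
  also have "\<dots> = integral {l t..r t} (\<lambda>x. v x * poly (p t) x * poly (pderiv q) x) + ?K"
    \<comment> \<open>Splitting requires both integrands to be integrable; continuity of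
      \<open>v\<close> gives this once \<open>u\<close> is replaced by \<open>p t\<close>.\<close>
    by (rule integral_add) (auto intro!: int continuous_intros v)
  also have "integral {l t..r t} (\<lambda>x. v x * poly (p t) x * poly (pderiv q) x) =
      integral {l t..r t} (\<lambda>x. v x * u x t * poly (pderiv q) x)"
    by (rule integral_cong_interior_Icc) (simp add: u[OF t])
  finally have R: "?G' = ?R + ?K"
    by (simp add: \<psi>Q qQ del: poly_mult)
  \<comment> \<open>Subtracting the derivative of \<open>?G - ?H\<close> gives one direction, adding
    it the other.\<close>
  have "(?G has_real_derivative ?R + ?K) (at t within S) \<longleftrightarrow>
      (?H has_real_derivative ?R) (at t within S)"
    using DERIV_diff[OF _ diff, of ?G "?R + ?K"] DERIV_add[OF _ diff, of ?H ?R] by auto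
  then show ?thesis
    unfolding R frozen_equation_def .
qed

text \<open>An invertible affine substitution permutes the polynomials of degree at most
  \<open>k\<close>, so quantifying over \<open>\<Psi>\<close> or over its frozen form is the
  same.\<close>

lemma ball_pcompose_affine_iff:
  assumes "c \<noteq> (0 :: real)"
  shows "(\<forall>\<Psi>. degree \<Psi> \<le> k \<longrightarrow> E (pcompose \<Psi> [:b, c:])) \<longleftrightarrow> (\<forall>q. degree q \<le> k \<longrightarrow> E q)"
  using assms
  by (metis degree_pcompose_affine_le order_trans pcompose_affine_inverse)

section \<open>Equivalence of the two schemes, time by time\<close>

theorem theorem3p4:
  fixes k N :: nat and t0 t1 :: real and a :: "real \<Rightarrow> real \<Rightarrow> real"
    and X \<nu> \<alpha> :: "int \<Rightarrow> real" and Fhat :: "int \<Rightarrow> real \<Rightarrow> real \<Rightarrow> real \<Rightarrow> real"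
    and u :: "real \<Rightarrow> real \<Rightarrow> real"
  assumes time: "t0 < t1"
    and partition: "space_time_partition N X \<nu> t0 t1"
    and a_cont: "continuous_on (UNIV \<times> {t0..t1}) (\<lambda>(x, t). a x t)"
    and a_periodic: "\<forall>t\<in>{t0..t1}. \<forall>x. a (x + (X (int N) - X 0)) t = a x t"
    and \<alpha>_periodic: "\<forall>j. \<alpha> (j + int N) = \<alpha> j"
    and flux: "numerical_flux N a X \<nu> t0 t1 Fhat"
    and u_dg: "dg_function k N X \<nu> t0 t1 u"
  shows "(gel_dg_scheme k a X \<nu> \<alpha> Fhat t0 t1 u \<longleftrightarrow> el_dg_scheme k a X \<nu> Fhat t0 t1 u) \<and>
    (\<forall>t\<in>{t0..t1}. gel_dg_at k a X \<nu> \<alpha> Fhat t0 t1 u t \<longleftrightarrow> el_dg_at k a X \<nu> Fhat t0 t1 u t)"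
proof -
  let ?S = "{t0..t1}" and ?l = "\<lambda>j. iface X \<nu> t1 (j - 1)" and ?r = "iface X \<nu> t1"
    and ?w = "cell_width X \<nu> t1"
  have pos: "?w j s > 0" if "s \<in> ?S" for j s
    using partition that by (simp add: space_time_partition_def)
  have mesh: "X (j - 1) < X j" for j
    using partition by (simp add: space_time_partition_def periodic_mesh_def)
  have le: "?l j s \<le> ?r j s" if "s \<in> ?S" for j s
    using pos[OF that, of j] by (simp add: cell_width_def)
  from u_dg obtain p where p: "\<And>j s. s \<in> ?S \<Longrightarrow> degree (p j s) \<le> k"
      "\<And>j s x. s \<in> ?S \<Longrightarrow> x \<in> interior {?l j s..?r j s} \<Longrightarrow> u x s = poly (p j s) x"
      "\<And>j i. (\<lambda>s. coeff (p j s) i) differentiable_on ?S"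
    unfolding dg_function_def cell_def by metis
  have pointwise: "gel_dg_at k a X \<nu> \<alpha> Fhat t0 t1 u t \<longleftrightarrow> el_dg_at k a X \<nu> Fhat t0 t1 u t"
    if t: "t \<in> ?S" for t
  proof -
    let ?E = "\<lambda>j. frozen_equation ?S (\<lambda>s. {?l j s..?r j s}) u (\<lambda>x. a x t)
      (flux_value Fhat X \<nu> t1 u j t) (flux_value Fhat X \<nu> t1 u (j - 1) t) (?l j t) (?r j t) t"
    have d_iface: "(iface X \<nu> t1 i has_real_derivative \<nu> i) (at t within ?S)" for i
      unfolding iface_def by (auto intro!: derivative_eq_intros)
    have d_width: "(?w j has_real_derivative \<nu> j - \<nu> (j - 1)) (at t within ?S)" for j
      unfolding cell_width_def by (intro derivative_intros d_iface)
    have "\<exists>D. ((\<lambda>s. coeff (p j s) i) has_real_derivative D) (at t within ?S)" for j i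
      using p(3)[of j i] t
      by (auto simp: differentiable_on_def real_differentiable_def)
    then obtain d where d: "\<And>j i. ((\<lambda>s. coeff (p j s) i) has_real_derivative d j i) (at t within ?S)"
      by metis
    \<comment> \<open>The coefficients beyond \<open>k\<close> vanish on the whole time interval, so
      their derivatives are 0 and the truncated sum is the full derivative.\<close>
    have "has_poly_derivative (p j) (\<Sum>i\<le>k. monom (d j i) i) t ?S" for j
      unfolding has_poly_derivative_def
    proof
      fix i
      have "((\<lambda>s. coeff (p j s) i) has_real_derivative 0) (at t within ?S)" if "i > k"
      proof (rule has_real_derivative_transform_within_set[OF t, where g = "\<lambda>s. 0"])
        show "coeff (p j s) i = 0" if "s \<in> ?S" for s
          using p(1)[OF that, of j] \<open>i > k\<close> by (intro coeff_eq_0) auto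
      qed simp
      then show "((\<lambda>s. coeff (p j s) i) has_real_derivative coeff (\<Sum>i\<le>k. monom (d j i) i) i)
          (at t within ?S)"
        using d[of j i] by (cases "i \<le> k") (auto simp: coeff_sum)
    qed
    note dp = this
    have "continuous_on UNIV (\<lambda>x. case (x, t) of (x, t) \<Rightarrow> a x t)"
      by (rule continuous_on_compose2[OF a_cont]) (use t in \<open>auto intro!: continuous_intros\<close>)
    then have v: "continuous_on {x..y} (\<lambda>x. a x t)" for x y
      by (auto intro: continuous_on_subset)
    \<comment> \<open>\<open>?E\<close> involves neither \<open>\<alpha>\<close> nor the EL
      velocity, so both schemes reduce to the same frozen equation.\<close>
    have frozen: "((\<lambda>s. integral {?l j s..?r j s} (\<lambda>x. u x s * \<psi> x s)) has_real_derivative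
        - flux_value Fhat X \<nu> t1 u j t * \<psi> (?r j t) t
        + flux_value Fhat X \<nu> t1 u (j - 1) t * \<psi> (?l j t) t
        + integral {?l j t..?r j t} (\<lambda>x. (a x t - \<beta> x) * u x t * deriv (\<lambda>y. \<psi> y t) x))
        (at t within ?S) \<longleftrightarrow> ?E j (pcompose \<Psi> [:b t, c t:])"
      if "(b has_real_derivative b') (at t within ?S)" "(c has_real_derivative c') (at t within ?S)"
        "\<And>x s. \<psi> x s = poly \<Psi> (b s + c s * x)" "\<And>x. \<beta> x * c t = - (b' + c' * x)"
      for j b b' c c' \<beta> \<psi> \<Psi>
      by (rule moving_test_equation_iff_frozen[where p = "p j" and k = k])
        (use that t in \<open>auto intro: le d_iface p dp v\<close>)
    have b: "((\<lambda>s. - \<alpha> j * (s - t1)) has_real_derivative - \<alpha> j) (at t within ?S)" for j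
      by (auto intro!: derivative_eq_intros)
    have test: "gel_test \<alpha> t1 j \<Psi> x s = poly \<Psi> (- \<alpha> j * (s - t1) + 1 * x)" for j \<Psi> x s
      by (simp add: gel_test_def)
    have velocity: "\<alpha> j * 1 = - (- \<alpha> j + 0 * x)" for j and x :: real
      by simp
    have gel: "gel_dg_at k a X \<nu> \<alpha> Fhat t0 t1 u t \<longleftrightarrow>
        (\<forall>j \<Psi>. degree \<Psi> \<le> k \<longrightarrow> ?E j (pcompose \<Psi> [:- \<alpha> j * (t - t1), 1:]))"
      unfolding gel_dg_at_def cell_def
      by (subst frozen[OF b DERIV_const test velocity]) auto
    let ?h = "\<lambda>j. X j - X (j - 1)"
    \<comment> \<open>Constant term and slope, as functions of time, of the affine argument of
      \<open>\<Psi>\<close> in \<open>el_test\<close>.\<close>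
    let ?b = "\<lambda>j s. X (j - 1) - ?l j s / ?w j s * ?h j" and ?c = "\<lambda>j s. ?h j / ?w j s"
    have wt: "?w j t \<noteq> 0" for j using pos[OF t, of j] by simp
    have b: "(?b j has_real_derivative
        - ((\<nu> (j - 1) * ?w j t - ?l j t * (\<nu> j - \<nu> (j - 1))) / (?w j t * ?w j t) * ?h j))
        (at t within ?S)" for j
      by (rule derivative_eq_intros d_iface d_width refl wt)+ simp
    have c: "(?c j has_real_derivative
        - (?h j * (\<nu> j - \<nu> (j - 1)) / (?w j t * ?w j t))) (at t within ?S)" for j
      by (rule derivative_eq_intros d_iface d_width refl wt)+ simp
    have test: "el_test X \<nu> t1 j \<Psi> x s = poly \<Psi> (?b j s + ?c j s * x)" for j \<Psi> x s
      by (simp add: el_test_def diff_divide_distrib algebra_simps)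
    have velocity: "el_velocity X \<nu> t1 j x t * ?c j t =
        - (- ((\<nu> (j - 1) * ?w j t - ?l j t * (\<nu> j - \<nu> (j - 1))) / (?w j t * ?w j t) * ?h j)
           + - (?h j * (\<nu> j - \<nu> (j - 1)) / (?w j t * ?w j t)) * x)" for j x
    proof -
      have r: "?r j t = ?l j t + ?w j t" by (simp add: cell_width_def)
      show ?thesis
        unfolding el_velocity_def r using wt[of j] by (simp add: field_simps)
    qed
    have el: "el_dg_at k a X \<nu> Fhat t0 t1 u t \<longleftrightarrow>
        (\<forall>j \<Psi>. degree \<Psi> \<le> k \<longrightarrow> ?E j (pcompose \<Psi> [:?b j t, ?c j t:]))"
      unfolding el_dg_at_def cell_def
      by (subst frozen[OF b c test velocity]) auto
    have "?c j t \<noteq> 0" for j using wt[of j] mesh[of j] by simp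
    then show ?thesis
      unfolding gel el by (simp add: ball_pcompose_affine_iff)
  qed
  then show ?thesis
    by (auto simp: gel_dg_scheme_def el_dg_scheme_def)
qed

end
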